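(* Consider a data structure consisting of a finite set of nodes, each node $x$ having a distinct key (from a totally ordered set), a membership vector $m(x)\in\Sigma^\omega$, and, for every level $\ell\ge 0$, a right pointer $xR_\ell$ and a left pointer $xL_\ell$, each equal either to a node or to $\bot$. Then every connected component of the data structure is a skip graph if and only if, for every node $x$ and every level $\ell \ge 0$, the following six constraints hold: (1) if $xR_\ell \ne \bot$ then $xR_\ell > x$; (2) if $xL_\ell \ne \bot$ then $xL_\ell < x$; (3) if $xR_\ell \ne \bot$ then $xR_\ell L_\ell = x$; (4) if $xL_\ell \ne \bot$ then $xL_\ell R_\ell = x$; (5) if there is $k\ge 1$ with $xR_\ell^k\neq\bot$, $m(x)\upharpoonright(\ell+1) = m(xR_\ell^k)\upharpoonright(\ell+1)$, and no $j$ with $1\le j<k$ satisfies $m(x)\upharpoonright(\ell+1) = m(xR_\ell^j)\upharpoonright(\ell+1)$, then $xR_{\ell+1} = xR_\ell^k$; otherwise $xR_{\ell+1} = \bot$; (6) if there is $k\ge 1$ with $xL_\ell^k\neq\bot$, $m(x)\upharpoonright(\ell+1) = m(xL_\ell^k)\upharpoonright(\ell+1)$, and no $j$ with $1\le j<k$ satisfies $m(x)\upharpoonright(\ell+1) = m(xL_\ell^j)\upharpoonright(\ell+1)$, then $xL_{\ell+1} = xL_\ell^k$; otherwise $xL_{\ell+1} = \bot$.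
   Context: $\Sigma$ is a finite alphabet, $w\upharpoonright i$ is the length-$i$ prefix of a word $w$. Nodes are compared by their keys. Pointer expressions compose left to right: $xR_\ell L_\ell$ is the left level-$\ell$ pointer of the node $xR_\ell$, and $xR_\ell^k$ is the result of following the right level-$\ell$ pointer $k$ times (any expression passing through $\bot$ is $\bot$). The connected components are those of the undirected graph on the nodes with an edge between $x$ and $y$ whenever $y = xR_\ell$ or $y = xL_\ell$ for some $\ell$. A set $C$ of nodes (with its pointers) is a skip graph if for every $x\in C$ and every $\ell\ge 0$, $xR_\ell$ is the immediate successor of $x$ (by key) in the list of all nodes $y\in C$ with $m(y)\upharpoonright\ell = m(x)\upharpoonright\ell$, or $\bot$ if there is none, and $xL_\ell$ is likewise the immediate predecessor of $x$ in that list, or $\bot$ if there is none. *)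

theory Defs
  imports Main "HOL-Library.Stream"
begin

text \<open>
  \<^const>\<open>None\<close> plays the role of the null pointer. Words in the infinite product of the
  alphabet are streams, and \<open>stake i w\<close> is the prefix of length \<open>i\<close> of \<open>w\<close>.
\<close>

record ('n, 'k, 's) pointer_structure =
  nodes :: "'n set"
  key :: "'n \<Rightarrow> 'k"
  mvec :: "'n \<Rightarrow> 's stream"
  right :: "nat \<Rightarrow> 'n \<Rightarrow> 'n option"
  left :: "nat \<Rightarrow> 'n \<Rightarrow> 'n option"

definition wf_structure :: "'s set \<Rightarrow> ('n, 'k :: linorder, 's) pointer_structure \<Rightarrow> bool" where
  "wf_structure \<Sigma> D \<longleftrightarrow>
     finite \<Sigma> \<and> finite (nodes D) \<and> inj_on (key D) (nodes D) \<and>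
     (\<forall>x\<in>nodes D. mvec D x \<in> streams \<Sigma>) \<and>
     (\<forall>x\<in>nodes D. \<forall>l. right D l x \<in> insert None (Some ` nodes D)) \<and>
     (\<forall>x\<in>nodes D. \<forall>l. left D l x \<in> insert None (Some ` nodes D))"

definition adjacent :: "('n, 'k, 's) pointer_structure \<Rightarrow> ('n \<times> 'n) set" where
  "adjacent D = {(x, y). x \<in> nodes D \<and> y \<in> nodes D \<and>
     (\<exists>l. right D l x = Some y \<or> left D l x = Some y \<or>
          right D l y = Some x \<or> left D l y = Some x)}"

definition components :: "('n, 'k, 's) pointer_structure \<Rightarrow> 'n set set" where
  "components D = nodes D // (adjacent D)\<^sup>*"

text \<open>
  The list is represented by its set of members: keys are distinct on nodes, so the ordering by
  key is determined by the set.
\<close>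

definition level_list ::
    "('n, 'k, 's) pointer_structure \<Rightarrow> 'n set \<Rightarrow> nat \<Rightarrow> 'n \<Rightarrow> 'n set" where
  "level_list D C l x = {y \<in> C. stake l (mvec D y) = stake l (mvec D x)}"

definition immediate_succ ::
    "('n, 'k :: linorder, 's) pointer_structure \<Rightarrow> 'n set \<Rightarrow> 'n \<Rightarrow> 'n \<Rightarrow> bool" where
  "immediate_succ D S x y \<longleftrightarrow>
     y \<in> S \<and> key D x < key D y \<and> \<not> (\<exists>z\<in>S. key D x < key D z \<and> key D z < key D y)"

definition immediate_pred ::
    "('n, 'k :: linorder, 's) pointer_structure \<Rightarrow> 'n set \<Rightarrow> 'n \<Rightarrow> 'n \<Rightarrow> bool" where
  "immediate_pred D S x y \<longleftrightarrow>
     y \<in> S \<and> key D y < key D x \<and> \<not> (\<exists>z\<in>S. key D y < key D z \<and> key D z < key D x)"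

definition skip_graph ::
    "('n, 'k :: linorder, 's) pointer_structure \<Rightarrow> 'n set \<Rightarrow> bool" where
  "skip_graph D C \<longleftrightarrow> (\<forall>x\<in>C. \<forall>l.
     (case right D l x of
        Some y \<Rightarrow> immediate_succ D (level_list D C l x) x y
      | None \<Rightarrow> \<not> (\<exists>y. immediate_succ D (level_list D C l x) x y)) \<and>
     (case left D l x of
        Some y \<Rightarrow> immediate_pred D (level_list D C l x) x y
      | None \<Rightarrow> \<not> (\<exists>y. immediate_pred D (level_list D C l x) x y)))"

definition follow :: "('n \<Rightarrow> 'n option) \<Rightarrow> nat \<Rightarrow> 'n \<Rightarrow> 'n option" where
  "follow p k x = ((\<lambda>q. Option.bind q p) ^^ k) (Some x)"

definition prefix_match ::
    "('n, 'k, 's) pointer_structure \<Rightarrow> nat \<Rightarrow> 'n \<Rightarrow> 'n option \<Rightarrow> bool" where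
  "prefix_match D i x q \<longleftrightarrow>
     (\<exists>y. q = Some y \<and> stake i (mvec D x) = stake i (mvec D y))"

text \<open>At most one \<open>k\<close> satisfies \<open>first_match D p i x k\<close>.\<close>

definition first_match ::
    "('n, 'k, 's) pointer_structure \<Rightarrow> ('n \<Rightarrow> 'n option) \<Rightarrow> nat \<Rightarrow> 'n \<Rightarrow> nat \<Rightarrow> bool" where
  "first_match D p i x k \<longleftrightarrow>
     1 \<le> k \<and> prefix_match D i x (follow p k x) \<and>
     \<not> (\<exists>j. 1 \<le> j \<and> j < k \<and> prefix_match D i x (follow p j x))"

end

(*
  Left pointers are right pointers for the reversed order, so it suffices to treat successors in an
  arbitrary strict total order. If p is the successor function of every level-l list of C, then
  iterating p from x enumerates the later members of the list of x, so the first match of the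
  longer prefix is the successor in the level-(l+1) list. This gives constraints (5) and (6) from
  the skip graph property, and conversely the inductive step on levels. For the base of that
  induction, (5) and (6) make every pointer a composition of level-0 pointers, and (3) and (4) make
  the level-0 right pointer injective, so a component is a single increasing level-0 chain.
*)
theory Submission
  imports Defs
begin

section \<open>Iterated pointers and chains of edges\<close>

lemma follow_0 [simp]: "follow p 0 x = Some x"
  by (simp add: follow_def)

lemma follow_Suc: "follow p (Suc k) x = Option.bind (follow p k x) p"
  by (simp add: follow_def)

lemma follow_Suc': "follow p (Suc k) x = Option.bind (p x) (follow p k)"
proof (induction k)
  case 0
  have "Option.bind (p x) (follow p 0) = p x"
    by (cases "p x") auto
  then show ?case
    by (simp add: follow_Suc)
next
  case (Suc k)
  have "follow p (Suc (Suc k)) x = Option.bind (Option.bind (p x) (follow p k)) p"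
    using Suc follow_Suc by metis
  then show ?case
    by (cases "p x") (auto simp: follow_Suc)
qed

text \<open>Applied below with \<open>p\<close> a level-\<open>l\<close> pointer and
  \<open>T\<close> the level-0 right edges or their converse; it turns an iterated pointer into a
  walk along level 0.\<close>

lemma follow_rtrancl:
  assumes step: "\<And>u v. u \<in> N \<Longrightarrow> p u = Some v \<Longrightarrow> v \<in> N \<and> (u, v) \<in> T\<^sup>*"
    and "x \<in> N" "follow p k x = Some y"
  shows "y \<in> N \<and> (x, y) \<in> T\<^sup>*"
  using assms(3)
proof (induction k arbitrary: y)
  case 0
  with \<open>x \<in> N\<close> show ?case by simp
next
  case (Suc k)
  then obtain u where "follow p k x = Some u" "p u = Some y"
    by (auto simp: follow_Suc bind_eq_Some_conv)
  with Suc.IH step show ?case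
    by (meson rtrancl_trans)
qed

text \<open>Along a chain that cannot branch in either direction, zigzags cancel.\<close>

lemma rtrancl_Un_converse:
  assumes "single_valued R" "single_valued (R\<inverse>)" "(x, y) \<in> (R \<union> R\<inverse>)\<^sup>*"
  shows "(x, y) \<in> R\<^sup>* \<or> (y, x) \<in> R\<^sup>*"
  using assms(3)
proof (induction rule: rtrancl_induct)
  case base
  then show ?case by simp
next
  case (step y z)
  \<comment> \<open>A path and an edge leaving the same point of a functional relation are
    comparable. Quantifying over \<open>R\<close> lets the same fact serve for the converse
    relation.\<close>
  have fork: "(b, c) \<in> R\<^sup>* \<or> (c, b) \<in> R\<^sup>*"
    if "single_valued R" "(a, b) \<in> R\<^sup>*" "(a, c) \<in> R" for R :: "('a \<times> 'a) set" and a b c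
    using that single_valued_confluent by (metis r_into_rtrancl)
  show ?case
    using step.hyps(2) step.IH
  proof (elim UnE disjE)
    assume "(y, z) \<in> R" "(x, y) \<in> R\<^sup>*"
    then show ?thesis by (meson rtrancl.rtrancl_into_rtrancl)
  next
    assume "(y, z) \<in> R" "(y, x) \<in> R\<^sup>*"
    then show ?thesis using fork[OF assms(1)] by blast
  next
    assume "(y, z) \<in> R\<inverse>" "(x, y) \<in> R\<^sup>*"
    then show ?thesis
      using fork[OF assms(2), of y x z] by (auto simp: rtrancl_converse)
  next
    assume "(y, z) \<in> R\<inverse>" "(y, x) \<in> R\<^sup>*"
    then show ?thesis by (meson converseD converse_rtrancl_into_rtrancl)
  qed
qed

section \<open>Successors and successor pointers with respect to a strict order\<close>

definition is_succ :: "('n \<Rightarrow> 'n \<Rightarrow> bool) \<Rightarrow> 'n set \<Rightarrow> 'n \<Rightarrow> 'n \<Rightarrow> bool" where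
  "is_succ r S x y \<longleftrightarrow> y \<in> S \<and> r x y \<and> \<not> (\<exists>z\<in>S. r x z \<and> r z y)"

text \<open>The condition is imposed at the single node \<open>x\<close>, since in a skip graph the
  set \<open>S\<close> is the level list of \<open>x\<close> and so varies with the node.\<close>

definition succ_ptr :: "('n \<Rightarrow> 'n \<Rightarrow> bool) \<Rightarrow> 'n set \<Rightarrow> ('n \<Rightarrow> 'n option) \<Rightarrow> 'n \<Rightarrow> bool" where
  "succ_ptr r S p x \<longleftrightarrow>
     (case p x of Some y \<Rightarrow> is_succ r S x y | None \<Rightarrow> \<not> (\<exists>y. is_succ r S x y))"

lemma succ_ptr_Some: "succ_ptr r S p x \<Longrightarrow> p x = Some y \<Longrightarrow> is_succ r S x y"
  by (simp add: succ_ptr_def)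

lemma succ_ptr_None: "succ_ptr r S p x \<Longrightarrow> p x = None \<Longrightarrow> \<not> is_succ r S x y"
  by (auto simp: succ_ptr_def)

lemma skip_graph_iff_succ_ptr:
  "skip_graph D C \<longleftrightarrow> (\<forall>x\<in>C. \<forall>l.
     succ_ptr (\<lambda>u v. key D u < key D v) (level_list D C l x) (right D l) x \<and>
     succ_ptr (\<lambda>u v. key D v < key D u) (level_list D C l x) (left D l) x)"
proof -
  have "immediate_succ D S x y = is_succ (\<lambda>u v. key D u < key D v) S x y"
    "immediate_pred D S x y = is_succ (\<lambda>u v. key D v < key D u) S x y" for S x y
    by (auto simp: immediate_succ_def immediate_pred_def is_succ_def)
  then show ?thesis
    by (simp add: skip_graph_def succ_ptr_def cong: option.case_cong)
qed

lemma level_list_eq: "y \<in> level_list D C l x \<Longrightarrow> level_list D C l y = level_list D C l x"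
  by (auto simp: level_list_def)

lemma level_list_Suc_subset: "level_list D C (Suc l) x \<subseteq> level_list D C l x"
  by (auto simp: level_list_def stake_Suc simp del: stake.simps)

lemma first_match_exists:
  assumes "1 \<le> k" "prefix_match D i x (follow p k x)"
  shows "\<exists>k. first_match D p i x k"
proof -
  let ?P = "\<lambda>k. 1 \<le> k \<and> prefix_match D i x (follow p k x)"
  have "?P (LEAST k. ?P k)"
    using assms by (intro LeastI[of ?P k]) simp
  moreover have "\<not> ?P j" if "j < (LEAST k. ?P k)" for j
    using that by (rule not_less_Least)
  ultimately show ?thesis
    unfolding first_match_def by blast
qed

text \<open>Totality is asked on \<open>C\<close> only, since distinctness of keys is guaranteed on
  nodes alone; comparison of keys is irreflexive and transitive everywhere.\<close>

locale strict_total_order_on =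
  fixes r :: "'n \<Rightarrow> 'n \<Rightarrow> bool" and C :: "'n set"
  assumes fin: "finite C"
    and irrefl: "\<not> r x x"
    and trans: "r x y \<Longrightarrow> r y z \<Longrightarrow> r x z"
    and total: "x \<in> C \<Longrightarrow> y \<in> C \<Longrightarrow> x \<noteq> y \<Longrightarrow> r x y \<or> r y x"
begin

lemma converse_order: "strict_total_order_on (\<lambda>x y. r y x) C"
  using fin irrefl trans total by unfold_locales blast+

lemma is_succ_unique:
  assumes "S \<subseteq> C" "is_succ r S x y" "is_succ r S x z"
  shows "y = z"
  using assms total[of y z] by (auto simp: is_succ_def)

lemma is_succ_converse:
  "x \<in> S \<Longrightarrow> is_succ r S x y \<Longrightarrow> is_succ (\<lambda>x y. r y x) S y x"
  by (auto simp: is_succ_def)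

text \<open>Among the members of \<open>S\<close> above \<open>x\<close>, one with the fewest
  members of \<open>S\<close> strictly between \<open>x\<close> and it is a successor: any
  \<open>w\<close> in between would have fewer still.\<close>

lemma is_succ_exists:
  assumes "S \<subseteq> C" "z \<in> S" "r x z"
  shows "\<exists>y. is_succ r S x y"
proof -
  let ?card_below = "\<lambda>y. card {w \<in> S. r x w \<and> r w y}"
  obtain y where y: "y \<in> S \<and> r x y"
    and least: "\<And>w. w \<in> S \<and> r x w \<Longrightarrow> ?card_below y \<le> ?card_below w"
    using ex_has_least_nat[of "\<lambda>y. y \<in> S \<and> r x y" z ?card_below] assms(2,3) by blast
  have "\<not> (r x w \<and> r w y)" if "w \<in> S" for w
  proof
    assume w: "r x w \<and> r w y"
    have "{v \<in> S. r x v \<and> r v w} \<subset> {v \<in> S. r x v \<and> r v y}"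
      using that w irrefl trans by blast
    moreover have "finite {v \<in> S. r x v \<and> r v y}"
      using finite_subset[OF assms(1) fin] by simp
    ultimately have "?card_below w < ?card_below y"
      by (rule psubset_card_mono[rotated])
    then show False
      using least[of w] that w by simp
  qed
  with y show ?thesis
    unfolding is_succ_def by blast
qed

text \<open>\<open>x\<close> is a predecessor of \<open>y\<close> in \<open>S\<close>, so
  \<open>q y\<close> is not \<open>None\<close>, and predecessors are unique.\<close>

lemma succ_ptr_inverse:
  assumes "S \<subseteq> C" "x \<in> S" "p x = Some y"
    and "succ_ptr r S p x" "succ_ptr (\<lambda>x y. r y x) S q y"
  shows "q y = Some x"
proof -
  interpret conv: strict_total_order_on "\<lambda>x y. r y x" C
    by (rule converse_order)
  have pred: "is_succ (\<lambda>x y. r y x) S y x"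
    using assms succ_ptr_Some is_succ_converse by metis
  then show ?thesis
    using assms succ_ptr_None succ_ptr_Some conv.is_succ_unique by (metis option.exhaust)
qed

text \<open>Carries the level-0 statement from right to left pointers: a predecessor
  \<open>x\<close> of \<open>y\<close> has \<open>y\<close> as its successor, so
  \<open>p x = Some y\<close> and \<open>q\<close> must lead back from \<open>y\<close> to
  \<open>x\<close>.\<close>

lemma succ_ptr_of_inverse:
  assumes "S \<subseteq> C" "y \<in> S"
    and p: "\<And>x. x \<in> S \<Longrightarrow> succ_ptr r S p x"
    and pq: "\<And>x. x \<in> S \<Longrightarrow> p x = Some y \<Longrightarrow> q y = Some x"
    and qp: "\<And>x. q y = Some x \<Longrightarrow> x \<in> S \<and> p x = Some y"
  shows "succ_ptr (\<lambda>x y. r y x) S q y"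
proof (cases "q y")
  case (Some x)
  with p qp have "is_succ r S x y"
    by (meson succ_ptr_Some)
  with Some qp show ?thesis
    by (simp add: succ_ptr_def is_succ_converse)
next
  case None
  have False if "is_succ (\<lambda>x y. r y x) S y x" for x
  proof -
    have x: "x \<in> S" "is_succ r S x y"
      using that \<open>y \<in> S\<close> by (auto simp: is_succ_def)
    then obtain w where "p x = Some w" "is_succ r S x w"
      using p succ_ptr_None succ_ptr_Some by (metis option.exhaust)
    then have "p x = Some y"
      using x is_succ_unique \<open>S \<subseteq> C\<close> by metis
    with pq x None show False by force
  qed
  with None show ?thesis
    by (auto simp: succ_ptr_def)
qed

section \<open>Iterating a successor pointer within one list\<close>

context
  fixes S p
  assumes sub: "S \<subseteq> C" and succ: "\<And>u. u \<in> S \<Longrightarrow> succ_ptr r S p u"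
begin

lemma follow_mem:
  assumes "x \<in> S" "follow p k x = Some y"
  shows "y \<in> S \<and> (k \<noteq> 0 \<longrightarrow> r x y)"
  using assms(2)
proof (induction k arbitrary: y)
  case 0
  with \<open>x \<in> S\<close> show ?case by simp
next
  case (Suc k)
  then obtain u where u: "follow p k x = Some u" "p u = Some y"
    by (auto simp: follow_Suc bind_eq_Some_conv)
  with Suc.IH have IH: "u \<in> S" "k \<noteq> 0 \<longrightarrow> r x u"
    by auto
  have "y \<in> S \<and> r u y"
    using succ_ptr_Some[OF succ u(2)] \<open>u \<in> S\<close> by (auto simp: is_succ_def)
  with IH u show ?case
    using trans[of x u y] by (cases k) auto
qed

text \<open>A successor pointer jumps over no member: in the last step, from \<open>u\<close> to
  \<open>y\<close>, the node \<open>z\<close> cannot lie strictly between, so it is \<open>u\<close>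
  itself or is covered by induction.\<close>

lemma follow_between:
  assumes "x \<in> S" "follow p k x = Some y" "z \<in> S" "r x z" "r z y"
  shows "\<exists>j. 1 \<le> j \<and> j < k \<and> follow p j x = Some z"
  using assms(2,5)
proof (induction k arbitrary: y)
  case 0
  then show ?case using assms(4) irrefl trans by (metis follow_0 option.inject)
next
  case (Suc k)
  then obtain u where u: "follow p k x = Some u" "p u = Some y"
    by (auto simp: follow_Suc bind_eq_Some_conv)
  have "u \<in> S"
    using follow_mem \<open>x \<in> S\<close> u by blast
  have "\<not> r u z"
    using succ_ptr_Some[OF succ u(2)] \<open>u \<in> S\<close> Suc.prems(2) \<open>z \<in> S\<close> by (auto simp: is_succ_def)
  then consider "z = u" | "r z u"
    using total \<open>u \<in> S\<close> \<open>z \<in> S\<close> sub by blast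
  then show ?case
  proof cases
    case 1
    \<comment> \<open>The index \<open>k\<close> of \<open>u\<close> serves as \<open>j\<close>; it
      is positive because zero steps stay at \<open>x\<close>, while \<open>r x z\<close>.\<close>
    have "k \<noteq> 0"
      using 1 u assms(4) irrefl by (metis follow_0 option.inject)
    with 1 u show ?thesis by (intro exI[of _ k]) simp
  next
    case 2
    with Suc.IH u show ?thesis using less_Suc_eq by blast
  qed
qed

text \<open>Induction on the number of members of \<open>S\<close> above \<open>x\<close>: the
  successor \<open>y\<close> of \<open>x\<close> does not pass \<open>z\<close>, and fewer members
  lie above \<open>y\<close>.\<close>

lemma follow_reaches:
  assumes "x \<in> S" "z \<in> S" "r x z"
  shows "\<exists>k\<ge>1. follow p k x = Some z"
  using assms(1,3)
proof (induction "card {w \<in> S. r x w}" arbitrary: x rule: less_induct)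
  case less
  obtain y where y: "p x = Some y" "is_succ r S x y"
    using succ succ_ptr_None succ_ptr_Some is_succ_exists[OF sub assms(2)] less.prems
    by (metis option.exhaust)
  then have "y \<in> S" "r x y" "\<not> r z y"
    using assms(2) less.prems by (auto simp: is_succ_def)
  show ?case
  proof (cases "y = z")
    case True
    with y have "follow p 1 x = Some z" by (simp add: follow_Suc)
    then show ?thesis by blast
  next
    case False
    then have "r y z"
      using total \<open>y \<in> S\<close> assms(2) sub \<open>\<not> r z y\<close> by blast
    have "{w \<in> S. r y w} \<subset> {w \<in> S. r x w}"
      using \<open>y \<in> S\<close> \<open>r x y\<close> irrefl trans by blast
    then have "card {w \<in> S. r y w} < card {w \<in> S. r x w}"
      using finite_subset[OF sub fin] by (intro psubset_card_mono) auto
    with less.hyps \<open>y \<in> S\<close> \<open>r y z\<close> obtain k where "follow p k y = Some z"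
      by blast
    with y have "follow p (Suc k) x = Some z"
      by (simp add: follow_Suc')
    then show ?thesis by (intro exI[of _ "Suc k"]) simp
  qed
qed

end

section \<open>From the lists of one level to those of the next\<close>

context
  fixes D :: "('n, 'k :: linorder, 's) pointer_structure" and l p x
  assumes x: "x \<in> C" and succ: "\<And>u. u \<in> C \<Longrightarrow> succ_ptr r (level_list D C l u) p u"
begin

private lemma level_list_subset: "level_list D C l x \<subseteq> C"
  by (auto simp: level_list_def)

private lemma mem_level_list: "x \<in> level_list D C l x"
  using x by (simp add: level_list_def)

text \<open>All members of a level list share that list, so the hypothesis, whose set depends on the
  node, becomes a statement about one fixed set, as the results on iteration require.\<close>

private lemma succ_ptr_level_list:
  assumes "u \<in> level_list D C l x" shows "succ_ptr r (level_list D C l x) p u"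
  using succ[of u] level_list_eq[OF assms] level_list_subset assms by auto

text \<open>A node of the longer-prefix list strictly between \<open>x\<close> and \<open>y\<close>
  also lies in the level-\<open>l\<close> list, so \<open>p\<close> visits it before step
  \<open>k\<close>, against the minimality of \<open>k\<close>.\<close>

lemma first_match_is_succ:
  assumes "first_match D p (Suc l) x k"
  shows "\<exists>y. follow p k x = Some y \<and> is_succ r (level_list D C (Suc l) x) x y"
proof -
  \<comment> \<open>These are the premises of the results on iteration, with the
    level-\<open>l\<close> list of \<open>x\<close> as \<open>S\<close>.\<close>
  note facts = level_list_subset succ_ptr_level_list mem_level_list
  obtain y where y: "follow p k x = Some y"
      "stake (Suc l) (mvec D y) = stake (Suc l) (mvec D x)" and "1 \<le> k"
    and first: "\<And>j. 1 \<le> j \<Longrightarrow> j < k \<Longrightarrow> \<not> prefix_match D (Suc l) x (follow p j x)"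
    using assms unfolding first_match_def prefix_match_def by metis
  have mem: "y \<in> level_list D C l x" "r x y"
    using follow_mem[OF facts y(1)] \<open>1 \<le> k\<close> by auto
  have "\<not> (r x z \<and> r z y)" if z: "z \<in> level_list D C (Suc l) x" for z
  proof
    assume "r x z \<and> r z y"
    then obtain j where "1 \<le> j" "j < k" "follow p j x = Some z"
      using follow_between[OF facts y(1) subsetD[OF level_list_Suc_subset z]] by blast
    moreover have "stake (Suc l) (mvec D x) = stake (Suc l) (mvec D z)"
      using z by (simp add: level_list_def del: stake.simps)
    ultimately show False
      using first[of j] by (simp add: prefix_match_def del: stake.simps)
  qed
  with y mem show ?thesis
    by (simp add: is_succ_def level_list_def del: stake.simps)
qed

text \<open>The successor in the sparser list belongs to the level-\<open>l\<close> list as well, so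
  iterating \<open>p\<close> reaches it, and it matches the longer prefix.\<close>

lemma is_succ_first_match:
  assumes "is_succ r (level_list D C (Suc l) x) x y"
  shows "\<exists>k. first_match D p (Suc l) x k"
proof -
  note facts = level_list_subset succ_ptr_level_list mem_level_list
  from assms have y: "y \<in> level_list D C (Suc l) x" "r x y"
    by (auto simp: is_succ_def)
  then obtain k where "1 \<le> k" "follow p k x = Some y"
    using follow_reaches[OF facts subsetD[OF level_list_Suc_subset y(1)] y(2)] by blast
  with y show ?thesis
    by (intro first_match_exists[of k])
      (simp_all add: prefix_match_def level_list_def del: stake.simps)
qed

text \<open>Read left to right, this proves the constraints linking consecutive levels of a skip
  graph; read right to left, it is the inductive step on levels. A first match and a successor exist
  together, and the successor is unique.\<close>

lemma succ_ptr_Suc_iff: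
  "succ_ptr r (level_list D C (Suc l) x) q x \<longleftrightarrow>
     (\<forall>k. first_match D p (Suc l) x k \<longrightarrow> q x = follow p k x) \<and>
     ((\<nexists>k. first_match D p (Suc l) x k) \<longrightarrow> q x = None)"
  (is "?succ \<longleftrightarrow> ?match")
proof
  assume succ': ?succ
  have sub': "level_list D C (Suc l) x \<subseteq> C"
    by (auto simp: level_list_def)
  show ?match
  proof (intro conjI allI impI)
    fix k assume "first_match D p (Suc l) x k"
    then show "q x = follow p k x"
      using first_match_is_succ succ' succ_ptr_None succ_ptr_Some is_succ_unique[OF sub']
      by (metis option.exhaust)
  next
    assume "\<nexists>k. first_match D p (Suc l) x k"
    then show "q x = None"
      using is_succ_first_match succ' succ_ptr_Some by (metis option.exhaust)
  qed
next
  assume match: ?match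
  show ?succ
  proof (cases "\<exists>k. first_match D p (Suc l) x k")
    case True
    then show ?thesis
      using match first_match_is_succ by (force simp: succ_ptr_def)
  next
    case False
    then show ?thesis
      using match is_succ_first_match by (auto simp: succ_ptr_def)
  qed
qed

end

end

section \<open>Connected components\<close>

lemma sym_adjacent: "sym (adjacent D)"
  by (auto simp: sym_def adjacent_def)

lemma components_subset: "C \<in> components D \<Longrightarrow> C \<subseteq> nodes D"
proof
  fix y assume "C \<in> components D" "y \<in> C"
  then obtain x where "x \<in> nodes D" "(x, y) \<in> (adjacent D)\<^sup>*"
    by (auto simp: components_def quotient_def)
  from this(2,1) show "y \<in> nodes D"
    by (induction rule: rtrancl_induct) (auto simp: adjacent_def)
qed

text \<open>Symmetry of \<open>adjacent D\<close> lets any member represent its class.\<close>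

lemma components_eq:
  assumes "C \<in> components D" "x \<in> C"
  shows "C = (adjacent D)\<^sup>* `` {x}"
proof -
  obtain a where a: "C = (adjacent D)\<^sup>* `` {a}"
    using assms(1) by (auto simp: components_def quotient_def)
  with assms(2) have ax: "(a, x) \<in> (adjacent D)\<^sup>*"
    by simp
  then have "(x, a) \<in> (adjacent D)\<^sup>*"
    by (rule symD[OF sym_rtrancl[OF sym_adjacent]])
  with a ax show ?thesis
    by (auto intro: rtrancl_trans)
qed

lemma mem_component:
  "x \<in> nodes D \<Longrightarrow> (adjacent D)\<^sup>* `` {x} \<in> components D"
  by (auto simp: components_def quotient_def)

section \<open>Well-formed structures, and the constraints inside a skip graph\<close>

context
  fixes \<Sigma> :: "'s set" and D :: "('n, 'k :: linorder, 's) pointer_structure"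
  assumes wf: "wf_structure \<Sigma> D"
begin

lemma right_closed: "x \<in> nodes D \<Longrightarrow> right D l x = Some y \<Longrightarrow> y \<in> nodes D"
  using wf unfolding wf_structure_def by (metis image_iff insert_iff option.distinct(1) option.inject)

lemma left_closed: "x \<in> nodes D \<Longrightarrow> left D l x = Some y \<Longrightarrow> y \<in> nodes D"
  using wf unfolding wf_structure_def by (metis image_iff insert_iff option.distinct(1) option.inject)

lemma key_order:
  assumes "C \<subseteq> nodes D"
  shows "strict_total_order_on (\<lambda>u v. key D u < key D v) C"
proof
  show "finite C"
    using wf assms by (auto simp: wf_structure_def intro: finite_subset)
  show "key D x < key D y \<or> key D y < key D x" if "x \<in> C" "y \<in> C" "x \<noteq> y" for x y
    using wf assms that unfolding wf_structure_def inj_on_def by (metis neq_iff subsetD)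
qed auto

lemma skip_graph_imp_constraints:
  assumes C: "skip_graph D C" "C \<subseteq> nodes D" and x: "x \<in> C"
  shows "(\<forall>y. right D l x = Some y \<longrightarrow> key D y > key D x) \<and>
       (\<forall>y. left D l x = Some y \<longrightarrow> key D y < key D x) \<and>
       (right D l x \<noteq> None \<longrightarrow> Option.bind (right D l x) (left D l) = Some x) \<and>
       (left D l x \<noteq> None \<longrightarrow> Option.bind (left D l x) (right D l) = Some x) \<and>
       (\<forall>k. first_match D (right D l) (l + 1) x k \<longrightarrow>
              right D (l + 1) x = follow (right D l) k x) \<and>
       ((\<nexists>k. first_match D (right D l) (l + 1) x k) \<longrightarrow> right D (l + 1) x = None) \<and>
       (\<forall>k. first_match D (left D l) (l + 1) x k \<longrightarrow>
              left D (l + 1) x = follow (left D l) k x) \<and>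
       ((\<nexists>k. first_match D (left D l) (l + 1) x k) \<longrightarrow> left D (l + 1) x = None)"
proof -
  let ?L = "level_list D C l x"
  interpret up: strict_total_order_on "\<lambda>u v. key D u < key D v" C
    by (rule key_order[OF C(2)])
  \<comment> \<open>Reversing the keys turns predecessors into successors, so left pointers fall
    under the same lemmas.\<close>
  interpret down: strict_total_order_on "\<lambda>u v. key D v < key D u" C
    by (rule up.converse_order)
  have R: "succ_ptr (\<lambda>u v. key D u < key D v) (level_list D C l u) (right D l) u"
    and L: "succ_ptr (\<lambda>u v. key D v < key D u) (level_list D C l u) (left D l) u"
    if "u \<in> C" for u l
    using that C(1) by (auto simp: skip_graph_iff_succ_ptr)
  have sub: "?L \<subseteq> C" and mem: "x \<in> ?L"
    using x by (auto simp: level_list_def)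
  have right: "y \<in> ?L \<and> key D x < key D y" if "right D l x = Some y" for y
    using succ_ptr_Some[OF R[OF x] that] by (auto simp: is_succ_def)
  have left: "y \<in> ?L \<and> key D y < key D x" if "left D l x = Some y" for y
    using succ_ptr_Some[OF L[OF x] that] by (auto simp: is_succ_def)
  have "left D l y = Some x" if "right D l x = Some y" for y
  proof (rule up.succ_ptr_inverse[OF sub mem that R[OF x]])
    \<comment> \<open>Neighbours at level \<open>l\<close> share their level list, so the condition
      on the left pointer of \<open>y\<close> refers to \<open>?L\<close> too.\<close>
    show "succ_ptr (\<lambda>u v. key D v < key D u) ?L (left D l) y"
      using L[of y] right[OF that] level_list_eq sub by (metis subsetD)
  qed
  moreover have "right D l y = Some x" if "left D l x = Some y" for y
  proof (rule down.succ_ptr_inverse[OF sub mem that L[OF x]])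
    show "succ_ptr (\<lambda>u v. key D u < key D v) ?L (right D l) y"
      using R[of y] left[OF that] level_list_eq sub by (metis subsetD)
  qed
  ultimately show ?thesis
    using right left up.succ_ptr_Suc_iff[where q = "right D (Suc l)" and l = l, OF x R]
      down.succ_ptr_Suc_iff[where q = "left D (Suc l)" and l = l, OF x L] R[OF x] L[OF x]
    by auto
qed

section \<open>The constraints make every component a skip graph\<close>

context
  assumes right_greater: "\<And>x y l. x \<in> nodes D \<Longrightarrow> right D l x = Some y \<Longrightarrow> key D x < key D y"
    and right_left: "\<And>x y l. x \<in> nodes D \<Longrightarrow> right D l x = Some y \<Longrightarrow> left D l y = Some x"
    and left_right: "\<And>x y l. x \<in> nodes D \<Longrightarrow> left D l x = Some y \<Longrightarrow> right D l y = Some x"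
    and right_match: "\<And>x l. x \<in> nodes D \<Longrightarrow>
       (\<forall>k. first_match D (right D l) (Suc l) x k \<longrightarrow>
              right D (Suc l) x = follow (right D l) k x) \<and>
       ((\<nexists>k. first_match D (right D l) (Suc l) x k) \<longrightarrow> right D (Suc l) x = None)"
    and left_match: "\<And>x l. x \<in> nodes D \<Longrightarrow>
       (\<forall>k. first_match D (left D l) (Suc l) x k \<longrightarrow>
              left D (Suc l) x = follow (left D l) k x) \<and>
       ((\<nexists>k. first_match D (left D l) (Suc l) x k) \<longrightarrow> left D (Suc l) x = None)"
begin

private definition R where "R = {(x, y). x \<in> nodes D \<and> right D 0 x = Some y}"

text \<open>By the matching constraint, a pointer of level \<open>l + 1\<close> is a finite
  iteration of the level-\<open>l\<close> pointer, so induction on \<open>l\<close> reduces it to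
  level 0.\<close>

private lemma right_rtrancl:
  "x \<in> nodes D \<Longrightarrow> right D l x = Some y \<Longrightarrow> (x, y) \<in> R\<^sup>*"
proof (induction l arbitrary: x y)
  case 0
  then show ?case by (auto simp: R_def)
next
  case (Suc l)
  then obtain k where "follow (right D l) k x = Some y"
    using right_match by (metis option.distinct(1))
  then show ?case
    using follow_rtrancl[of "nodes D" "right D l" R] Suc right_closed by blast
qed

private lemma left_rtrancl:
  "x \<in> nodes D \<Longrightarrow> left D l x = Some y \<Longrightarrow> (x, y) \<in> (R\<inverse>)\<^sup>*"
proof (induction l arbitrary: x y)
  case 0
  then show ?case using left_right left_closed by (auto simp: R_def)
next
  case (Suc l)
  then obtain k where "follow (left D l) k x = Some y"
    using left_match by (metis option.distinct(1))
  then show ?case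
    using follow_rtrancl[of "nodes D" "left D l" "R\<inverse>"] Suc left_closed by blast
qed

private lemma adjacent_rtrancl: "(x, y) \<in> (adjacent D)\<^sup>* \<Longrightarrow> (x, y) \<in> (R \<union> R\<inverse>)\<^sup>*"
proof (induction rule: rtrancl_induct)
  case base
  then show ?case by simp
next
  case (step y z)
  have "(y, z) \<in> R\<^sup>* \<union> (R\<inverse>)\<^sup>*"
    using step(2) right_rtrancl left_rtrancl
    unfolding adjacent_def by (auto simp: rtrancl_converse)
  then have "(y, z) \<in> (R \<union> R\<inverse>)\<^sup>*"
    using rtrancl_mono[of R "R \<union> R\<inverse>"] rtrancl_mono[of "R\<inverse>" "R \<union> R\<inverse>"] by blast
  with step.IH show ?case by (rule rtrancl_trans)
qed

private lemma R_rtrancl_key: "(x, y) \<in> R\<^sup>* \<Longrightarrow> key D x \<le> key D y"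
  by (induction rule: rtrancl_induct) (auto simp: R_def dest: right_greater)

text \<open>Members of a component are joined by level-0 edges and their converses. As
  \<open>R\<close> branches neither way, they lie on one chain along which keys grow; it runs from
  \<open>x\<close> to \<open>y\<close>, and its first edge gives \<open>z\<close>.\<close>

private lemma component_right_step:
  assumes "C \<in> components D" "x \<in> C" "y \<in> C" "key D x < key D y"
  shows "\<exists>z. right D 0 x = Some z \<and> key D z \<le> key D y"
proof -
  have "(x, y) \<in> (adjacent D)\<^sup>*"
    using components_eq[OF assms(1,2)] assms(3) by simp
  \<comment> \<open>Two nodes with the same right neighbour are both its left neighbour, hence
    equal; this makes the converse single-valued.\<close>
  moreover have "single_valued R" "single_valued (R\<inverse>)"
    using right_left by (auto simp: R_def single_valued_def) (metis option.inject)
  ultimately have "(x, y) \<in> R\<^sup>* \<or> (y, x) \<in> R\<^sup>*"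
    using adjacent_rtrancl rtrancl_Un_converse by metis
  \<comment> \<open>A chain from \<open>y\<close> to \<open>x\<close> would force
    \<open>key D y \<le> key D x\<close>.\<close>
  with assms(4) have "(x, y) \<in> R\<^sup>*" "x \<noteq> y"
    using R_rtrancl_key[of y x] by auto
  then obtain z where "(x, z) \<in> R" "(z, y) \<in> R\<^sup>*"
    by (metis converse_rtranclE)
  then show ?thesis
    using R_rtrancl_key by (auto simp: R_def)
qed

lemma constraints_imp_skip_graph:
  assumes C: "C \<in> components D"
  shows "skip_graph D C"
proof -
  have sub: "C \<subseteq> nodes D"
    using C by (rule components_subset)
  interpret up: strict_total_order_on "\<lambda>u v. key D u < key D v" C
    by (rule key_order[OF sub])
  interpret down: strict_total_order_on "\<lambda>u v. key D v < key D u" C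
    by (rule up.converse_order)
  have level_0: "level_list D C 0 x = C" for x
    by (simp add: level_list_def)
  have adj: "y \<in> C" if "x \<in> C" "(x, y) \<in> adjacent D" for x y
    using that components_eq[OF C that(1)] by blast
  have right_mem: "y \<in> C" if "x \<in> C" "right D l x = Some y" for x y l
    using adj[OF that(1)] that right_closed sub unfolding adjacent_def by blast
  have left_mem: "y \<in> C" if "x \<in> C" "left D l x = Some y" for x y l
    using adj[OF that(1)] that left_closed sub unfolding adjacent_def by blast
  have R0: "succ_ptr (\<lambda>u v. key D u < key D v) C (right D 0) x" if x: "x \<in> C" for x
  proof (cases "right D 0 x")
    case None
    then show ?thesis
      using component_right_step[OF C x] by (auto simp: succ_ptr_def is_succ_def)
  next
    case (Some y)
    \<comment> \<open>The right neighbour of \<open>x\<close> is at most any member \<open>z\<close>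
      of \<open>C\<close> above \<open>x\<close>, so no such \<open>z\<close> precedes
      \<open>y\<close>.\<close>
    have "\<not> (key D x < key D z \<and> key D z < key D y)" if "z \<in> C" for z
      using component_right_step[OF C x that] Some by auto
    then show ?thesis
      using Some right_mem[OF x Some] right_greater[of x 0 y] x sub
      by (auto simp: succ_ptr_def is_succ_def)
  qed
  have L0: "succ_ptr (\<lambda>u v. key D v < key D u) C (left D 0) x" if x: "x \<in> C" for x
  proof (rule up.succ_ptr_of_inverse[OF subset_refl x R0])
    show "left D 0 x = Some y" if "y \<in> C" "right D 0 y = Some x" for y
      using right_left that sub by blast
    show "y \<in> C \<and> right D 0 y = Some x" if "left D 0 x = Some y" for y
      using left_mem[OF x that] left_right[of x 0 y] that x sub by blast
  qed
  have "succ_ptr (\<lambda>u v. key D u < key D v) (level_list D C l x) (right D l) x"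
    if "x \<in> C" for l x
    using that
  \<comment> \<open>The node stays arbitrary because \<open>succ_ptr_Suc_iff\<close> asks for the
    level-\<open>l\<close> condition at every member of \<open>C\<close>.\<close>
  proof (induction l arbitrary: x)
    case 0
    then show ?case by (simp add: level_0 R0)
  next
    case (Suc l)
    have "x \<in> nodes D"
      using Suc.prems sub by blast
    then show ?case
      by (intro up.succ_ptr_Suc_iff[OF Suc.prems Suc.IH, THEN iffD2] right_match)
  qed
  moreover have "succ_ptr (\<lambda>u v. key D v < key D u) (level_list D C l x) (left D l) x"
    if "x \<in> C" for l x
    using that
  proof (induction l arbitrary: x)
    case 0
    then show ?case by (simp add: level_0 L0)
  next
    case (Suc l)
    have "x \<in> nodes D"
      using Suc.prems sub by blast
    then show ?case
      by (intro down.succ_ptr_Suc_iff[OF Suc.prems Suc.IH, THEN iffD2] left_match)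
  qed
  ultimately show ?thesis
    by (simp add: skip_graph_iff_succ_ptr)
qed

end

end

theorem theorem1:
  fixes \<Sigma> :: "'s set"
    and D :: "('n, 'k :: linorder, 's) pointer_structure"
  assumes "wf_structure \<Sigma> D"
  shows "(\<forall>C\<in>components D. skip_graph D C) \<longleftrightarrow>
    (\<forall>x\<in>nodes D. \<forall>l.
       (\<forall>y. right D l x = Some y \<longrightarrow> key D y > key D x) \<and>
       (\<forall>y. left D l x = Some y \<longrightarrow> key D y < key D x) \<and>
       (right D l x \<noteq> None \<longrightarrow> Option.bind (right D l x) (left D l) = Some x) \<and>
       (left D l x \<noteq> None \<longrightarrow> Option.bind (left D l x) (right D l) = Some x) \<and>
       (\<forall>k. first_match D (right D l) (l + 1) x k \<longrightarrow>
              right D (l + 1) x = follow (right D l) k x) \<and>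
       ((\<nexists>k. first_match D (right D l) (l + 1) x k) \<longrightarrow> right D (l + 1) x = None) \<and>
       (\<forall>k. first_match D (left D l) (l + 1) x k \<longrightarrow>
              left D (l + 1) x = follow (left D l) k x) \<and>
       ((\<nexists>k. first_match D (left D l) (l + 1) x k) \<longrightarrow> left D (l + 1) x = None))"
  (is "_ \<longleftrightarrow> (\<forall>x\<in>nodes D. \<forall>l. ?constraints x l)")
proof
  assume skip: "\<forall>C\<in>components D. skip_graph D C"
  show "\<forall>x\<in>nodes D. \<forall>l. ?constraints x l"
  proof (intro ballI allI)
    fix x l assume "x \<in> nodes D"
    \<comment> \<open>The constraints at \<open>x\<close> are read off the component of
      \<open>x\<close> itself.\<close>
    then have C: "(adjacent D)\<^sup>* `` {x} \<in> components D"
      by (rule mem_component)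
    show "?constraints x l"
      by (rule skip_graph_imp_constraints[OF assms _ components_subset[OF C]])
        (use skip C in auto)
  qed
next
  assume "\<forall>x\<in>nodes D. \<forall>l. ?constraints x l"
  then have constraints: "?constraints x l" if "x \<in> nodes D" for x l
    using that by blast
  show "\<forall>C\<in>components D. skip_graph D C"
  proof (rule ballI, rule constraints_imp_skip_graph[OF assms])
    fix x l assume x: "x \<in> nodes D"
    note at = constraints[OF x, of l]
    show "key D x < key D y" if "right D l x = Some y" for y
      using at that by blast
    \<comment> \<open>Once the right pointer is \<open>Some y\<close>, the
      \<open>Option.bind\<close> in the constraint reduces to \<open>left D l y\<close>.\<close>
    show "left D l y = Some x" if "right D l x = Some y" for y
      using at that by auto
    show "right D l y = Some x" if "left D l x = Some y" for y
      using at that by auto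
    show "(\<forall>k. first_match D (right D l) (Suc l) x k \<longrightarrow>
              right D (Suc l) x = follow (right D l) k x) \<and>
       ((\<nexists>k. first_match D (right D l) (Suc l) x k) \<longrightarrow> right D (Suc l) x = None)"
      using at by simp
    show "(\<forall>k. first_match D (left D l) (Suc l) x k \<longrightarrow>
              left D (Suc l) x = follow (left D l) k x) \<and>
       ((\<nexists>k. first_match D (left D l) (Suc l) x k) \<longrightarrow> left D (Suc l) x = None)"
      using at by simp
  qed
qed

end
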